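(* For each pointed $\Pi$-model $(M,w)$ and $\Pi$-program $\Lambda$ of $\mathrm{GGMSC}$, $M,w\models\Lambda$ if and only if Eloise has a winning strategy in the global semantic game $\mathcal{G}^*(M,w,\Lambda)$.
   Context: $\mathrm{GGMSC}$ programs: over $\Pi$ and schema variables $\mathcal{T}$, each $X\in\mathcal{T}$ has a base rule $X(0) :- \varphi_X$ ($\varphi_X$ a formula of graded modal logic with counting global modality) and induction rule $X :- \psi_X$ ($\psi_X$ may contain variables from $\mathcal{T}$ as atoms), with a set of accepting predicates; $X^0:=\varphi_X$, $X^{n+1}$ is $\psi_X$ with each $Y$ replaced by $Y^n$; $M,w\models\Lambda$ iff $M,w\models X^n$ for some $n$ and accepting $X$. A labeled tuple over $M=(W,R,V)$ is a function $f\colon W\to\wp(\mathcal{T})$; $(M_f,v)\models\psi$ for a schema $\psi$ is defined as usual with $X$ true at $v$ iff $X\in f(v)$ (equivalently Eloise wins the standard evaluation game for $\psi$ on $M_f$ from $v$). The game $\mathcal{G}^*(M,w,\Lambda)$: positions are labeled tuples. Eloise first picks an initial position $f$ with $X\in f(w)$ for some accepting $X$ (if none exists, Abelard wins). In a position $f$, Eloise declares whether $f$ is final. If final, Abelard picks $v\in W$ and a head predicate $X$, and Eloise wins iff ($X\in f(v)$ iff $M,v\models\varphi_X$). Otherwise Eloise gives a labeled tuple $g$; Abelard either does not challenge (play continues from $g$) or challenges, picking $v\in W$ and head predicate $X$, and Eloise wins iff ($X\in f(v)$ iff $M_g,v\models\psi_X$). *)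

theory Defs
  imports Main "HOL-Library.FuncSet"
begin

section \<open>Graded modal logic with counting global modality\<close>

datatype (atoms: 'a) ggml =
    Top
  | Atom 'a
  | Neg "'a ggml"
  | Conj "'a ggml" "'a ggml"
  | Dia nat "'a ggml"
  | Glob nat "'a ggml"

record ('w, 'a) kripke =
  worlds :: "'w set"
  rel :: "('w \<times> 'w) set"
  val :: "'w \<Rightarrow> 'a set"

definition is_model :: "'a set \<Rightarrow> ('w, 'a) kripke \<Rightarrow> bool" where
  "is_model P M \<longleftrightarrow>
     worlds M \<noteq> {} \<and> rel M \<subseteq> worlds M \<times> worlds M \<and> (\<forall>v\<in>worlds M. val M v \<subseteq> P)"

definition is_pointed_model :: "'a set \<Rightarrow> ('w, 'a) kripke \<Rightarrow> 'w \<Rightarrow> bool" where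
  "is_pointed_model P M w \<longleftrightarrow> is_model P M \<and> w \<in> worlds M"

text \<open>Models may be infinite, so ``at least \<open>k\<close> elements'' is not expressed by \<^term>\<open>k \<le> card A\<close>.\<close>

definition at_least :: "nat \<Rightarrow> 'b set \<Rightarrow> bool" where
  "at_least k A \<longleftrightarrow> (\<exists>S\<subseteq>A. finite S \<and> card S = k)"

primrec sat :: "('w, 'a) kripke \<Rightarrow> 'w \<Rightarrow> 'a ggml \<Rightarrow> bool" where
  "sat M v Top \<longleftrightarrow> True"
| "sat M v (Atom p) \<longleftrightarrow> p \<in> val M v"
| "sat M v (Neg \<phi>) \<longleftrightarrow> \<not> sat M v \<phi>"
| "sat M v (Conj \<phi> \<psi>) \<longleftrightarrow> sat M v \<phi> \<and> sat M v \<psi>"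
| "sat M v (Dia k \<phi>) \<longleftrightarrow> at_least k {u \<in> worlds M. (v, u) \<in> rel M \<and> sat M u \<phi>}"
| "sat M v (Glob k \<phi>) \<longleftrightarrow> at_least k {u \<in> worlds M. sat M u \<phi>}"


section \<open>Programs\<close>

text \<open>A schema is a formula whose atoms are proposition symbols (\<^const>\<open>Inl\<close>) or schema
  variables (\<^const>\<open>Inr\<close>).\<close>

type_synonym ('p, 'x) schema = "('p + 'x) ggml"

record ('p, 'x) ggmsc =
  schema_vars :: "'x set"
  base :: "'x \<Rightarrow> 'p ggml"
  ind :: "'x \<Rightarrow> ('p, 'x) schema"
  accepting :: "'x set"

definition is_program :: "'p set \<Rightarrow> ('p, 'x) ggmsc \<Rightarrow> bool" where
  "is_program P \<Lambda> \<longleftrightarrow>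
     accepting \<Lambda> \<subseteq> schema_vars \<Lambda> \<and>
     (\<forall>X\<in>schema_vars \<Lambda>.
        atoms (base \<Lambda> X) \<subseteq> P \<and> atoms (ind \<Lambda> X) \<subseteq> Inl ` P \<union> Inr ` schema_vars \<Lambda>)"

primrec subst :: "('x \<Rightarrow> 'p ggml) \<Rightarrow> ('p, 'x) schema \<Rightarrow> 'p ggml" where
  "subst s Top = Top"
| "subst s (Atom a) = (case a of Inl p \<Rightarrow> Atom p | Inr X \<Rightarrow> s X)"
| "subst s (Neg \<phi>) = Neg (subst s \<phi>)"
| "subst s (Conj \<phi> \<psi>) = Conj (subst s \<phi>) (subst s \<psi>)"
| "subst s (Dia k \<phi>) = Dia k (subst s \<phi>)"
| "subst s (Glob k \<phi>) = Glob k (subst s \<phi>)"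

primrec iteration :: "('p, 'x) ggmsc \<Rightarrow> nat \<Rightarrow> 'x \<Rightarrow> 'p ggml" where
  "iteration \<Lambda> 0 = base \<Lambda>"
| "iteration \<Lambda> (Suc n) = (\<lambda>X. subst (iteration \<Lambda> n) (ind \<Lambda> X))"

definition accepts :: "('w, 'p) kripke \<Rightarrow> 'w \<Rightarrow> ('p, 'x) ggmsc \<Rightarrow> bool" where
  "accepts M w \<Lambda> \<longleftrightarrow> (\<exists>n. \<exists>X\<in>accepting \<Lambda>. sat M w (iteration \<Lambda> n X))"


section \<open>Two-player games\<close>

text \<open>States without moves are terminal; \<open>eloise_wins\<close> is only meaningful there.\<close>

record 's game =
  start :: 's
  moves :: "'s \<Rightarrow> 's set"
  eloise_turn :: "'s \<Rightarrow> bool"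
  eloise_wins :: "'s \<Rightarrow> bool"

text \<open>A strategy maps the history of the play, whose last element is the current state, to
  Eloise's next state. The following are the finite play prefixes consistent with it.\<close>

inductive consistent :: "'s game \<Rightarrow> ('s list \<Rightarrow> 's) \<Rightarrow> 's list \<Rightarrow> bool"
  for G :: "'s game" and \<sigma> :: "'s list \<Rightarrow> 's" where
  init: "consistent G \<sigma> [start G]"
| eloise: "\<lbrakk>consistent G \<sigma> h; eloise_turn G (last h); \<sigma> h \<in> moves G (last h)\<rbrakk>
    \<Longrightarrow> consistent G \<sigma> (h @ [\<sigma> h])"
| abelard: "\<lbrakk>consistent G \<sigma> h; \<not> eloise_turn G (last h); t \<in> moves G (last h)\<rbrakk>
    \<Longrightarrow> consistent G \<sigma> (h @ [t])"

text \<open>Eloise does not win an infinite play, so a winning strategy must exclude those.\<close>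

definition winning_strategy :: "'s game \<Rightarrow> ('s list \<Rightarrow> 's) \<Rightarrow> bool" where
  "winning_strategy G \<sigma> \<longleftrightarrow>
     (\<forall>h. consistent G \<sigma> h \<and> eloise_turn G (last h) \<and> moves G (last h) \<noteq> {}
        \<longrightarrow> \<sigma> h \<in> moves G (last h)) \<and>
     (\<forall>h. consistent G \<sigma> h \<and> moves G (last h) = {} \<longrightarrow> eloise_wins G (last h)) \<and>
     \<not> (\<exists>p :: nat \<Rightarrow> 's. \<forall>n. consistent G \<sigma> (map p [0..<Suc n]))"


section \<open>The global semantic game\<close>

type_synonym ('w, 'x) labeling = "'w \<Rightarrow> 'x set"

definition labeled_tuples :: "('w, 'p) kripke \<Rightarrow> ('p, 'x) ggmsc \<Rightarrow> ('w, 'x) labeling set" where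
  "labeled_tuples M \<Lambda> = worlds M \<rightarrow>\<^sub>E Pow (schema_vars \<Lambda>)"

definition expand :: "('w, 'p) kripke \<Rightarrow> ('w, 'x) labeling \<Rightarrow> ('w, 'p + 'x) kripke" where
  "expand M f = \<lparr>worlds = worlds M, rel = rel M, val = (\<lambda>v. Inl ` val M v \<union> Inr ` f v)\<rparr>"

text \<open>A round from the position \<open>f\<close> is split into single moves. Eloise moves from
  \<open>Position f\<close> either to \<open>Declared f\<close>, declaring \<open>f\<close> final, or to \<open>Offered f g\<close>. Abelard
  answers the former with \<open>FinalTest f v X\<close>, and the latter with \<open>Position g\<close> (no
  challenge) or \<open>Challenge f g v X\<close>.\<close>

datatype ('w, 'x) state =
    Start
  | Position "('w, 'x) labeling"
  | Declared "('w, 'x) labeling"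
  | FinalTest "('w, 'x) labeling" 'w 'x
  | Offered "('w, 'x) labeling" "('w, 'x) labeling"
  | Challenge "('w, 'x) labeling" "('w, 'x) labeling" 'w 'x

primrec gg_moves ::
  "('w, 'p) kripke \<Rightarrow> 'w \<Rightarrow> ('p, 'x) ggmsc \<Rightarrow> ('w, 'x) state \<Rightarrow> ('w, 'x) state set" where
  "gg_moves M w \<Lambda> Start =
     {Position f | f. f \<in> labeled_tuples M \<Lambda> \<and> (\<exists>X\<in>accepting \<Lambda>. X \<in> f w)}"
| "gg_moves M w \<Lambda> (Position f) = insert (Declared f) {Offered f g | g. g \<in> labeled_tuples M \<Lambda>}"
| "gg_moves M w \<Lambda> (Declared f) =
     {FinalTest f v X | v X. v \<in> worlds M \<and> X \<in> schema_vars \<Lambda>}"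
| "gg_moves M w \<Lambda> (FinalTest f v X) = {}"
| "gg_moves M w \<Lambda> (Offered f g) =
     insert (Position g) {Challenge f g v X | v X. v \<in> worlds M \<and> X \<in> schema_vars \<Lambda>}"
| "gg_moves M w \<Lambda> (Challenge f g v X) = {}"

primrec gg_eloise_turn :: "('w, 'x) state \<Rightarrow> bool" where
  "gg_eloise_turn Start = True"
| "gg_eloise_turn (Position f) = True"
| "gg_eloise_turn (Declared f) = False"
| "gg_eloise_turn (FinalTest f v X) = False"
| "gg_eloise_turn (Offered f g) = False"
| "gg_eloise_turn (Challenge f g v X) = False"

text \<open>\<open>Start\<close> is terminal exactly if Eloise has no initial position to pick, and then Abelard wins.
  \<open>Position\<close>, \<open>Offered\<close> and, in every play, \<open>Declared\<close> are non-terminal.\<close>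

primrec gg_eloise_wins ::
  "('w, 'p) kripke \<Rightarrow> ('p, 'x) ggmsc \<Rightarrow> ('w, 'x) state \<Rightarrow> bool" where
  "gg_eloise_wins M \<Lambda> Start = False"
| "gg_eloise_wins M \<Lambda> (Position f) = False"
| "gg_eloise_wins M \<Lambda> (Declared f) = False"
| "gg_eloise_wins M \<Lambda> (FinalTest f v X) = (X \<in> f v \<longleftrightarrow> sat M v (base \<Lambda> X))"
| "gg_eloise_wins M \<Lambda> (Offered f g) = False"
| "gg_eloise_wins M \<Lambda> (Challenge f g v X) = (X \<in> f v \<longleftrightarrow> sat (expand M g) v (ind \<Lambda> X))"

definition global_game ::
  "('w, 'p) kripke \<Rightarrow> 'w \<Rightarrow> ('p, 'x) ggmsc \<Rightarrow> ('w, 'x) state game" where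
  "global_game M w \<Lambda> =
     \<lparr>start = Start, moves = gg_moves M w \<Lambda>,
      eloise_turn = gg_eloise_turn, eloise_wins = gg_eloise_wins M \<Lambda>\<rparr>"

end

(* The labeling f_n that puts X into f_n(v) iff M,v satisfies X^n is the only one that passes every
   final test (n = 0), respectively every challenge against f_(n-1) (n > 0). So if M,w satisfies X^n
   for an accepting X, Eloise plays f_n, ..., f_0 and then declares f_0 final. Conversely, the
   consistent histories of a winning strategy are well-founded under extension, and induction
   along them shows that all positions occurring in them are of the form f_n. *)
theory Submission
  imports Defs
begin

section \<open>Winning strategies and well-foundedness\<close>

lemma consistent_nonempty: "consistent G \<sigma> h \<Longrightarrow> h \<noteq> []"
  by (erule consistent.cases) auto

lemma consistent_butlast:
  assumes "consistent G \<sigma> (h @ [t])" and "h \<noteq> []"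
  shows "consistent G \<sigma> h"
  using assms by (auto elim: consistent.cases)

lemma consistent_append:
  assumes "consistent G \<sigma> (h @ k)" and "h \<noteq> []"
  shows "consistent G \<sigma> h"
  using assms(1)
proof (induction k rule: rev_induct)
  case Nil
  then show ?case by simp
next
  case (snoc t k)
  have "consistent G \<sigma> ((h @ k) @ [t])"
    using snoc.prems by simp
  then have "consistent G \<sigma> (h @ k)"
    by (rule consistent_butlast) (use \<open>h \<noteq> []\<close> in simp)
  then show ?case by (rule snoc.IH)
qed

text \<open>\<open>Suc n\<close> keeps the prefix non-empty: every consistent history contains the
  start state.\<close>

lemma consistent_take:
  assumes "consistent G \<sigma> h"
  shows "consistent G \<sigma> (take (Suc n) h)"
proof (rule consistent_append)
  show "consistent G \<sigma> (take (Suc n) h @ drop (Suc n) h)"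
    using assms by simp
  show "take (Suc n) h \<noteq> []"
    using consistent_nonempty[OF assms] by simp
qed

text \<open>Bar induction on the tree of consistent histories: one that violates \<open>Q\<close>
  has a violating one-step extension, and iterating this would produce an infinite consistent
  play.\<close>

lemma winning_strategy_induct [consumes 2, case_names step]:
  assumes win: "winning_strategy G \<sigma>"
    and cons: "consistent G \<sigma> h"
    and step: "\<And>h. \<lbrakk>consistent G \<sigma> h; \<And>t. consistent G \<sigma> (h @ [t]) \<Longrightarrow> Q (h @ [t])\<rbrakk> \<Longrightarrow> Q h"
  shows "Q h"
proof (rule ccontr)
  assume "\<not> Q h"
  define B where "B \<equiv> \<lambda>h. consistent G \<sigma> h \<and> \<not> Q h"
  have "\<exists>H. \<forall>n. B (H n) \<and> (\<exists>t. H (Suc n) = H n @ [t])"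
  proof (rule dependent_nat_choice)
    show "\<exists>h. B h"
      using cons \<open>\<not> Q h\<close> by (auto simp: B_def)
    show "\<exists>h'. B h' \<and> (\<exists>t. h' = h @ [t])" if "B h" for h n
      using that step[of h] by (auto simp: B_def)
  qed
  then obtain H where B: "\<And>n. B (H n)" and ext: "\<And>n. \<exists>t. H (Suc n) = H n @ [t]"
    by blast
  \<comment> \<open>The chain may begin at a history of any positive length, so a lower bound is all
    that holds; it makes entry \<open>n\<close> of \<open>H n\<close> meaningful.\<close>
  have len: "n < length (H n)" for n
  proof (induction n)
    case 0
    show ?case
      using B[of 0] consistent_nonempty by (auto simp: B_def)
  next
    case (Suc n)
    then show ?case
      using ext[of n] by auto
  qed
  have nth: "H (i + k) ! i = H i ! i" for i k
  proof (induction k)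
    case (Suc k)
    obtain t where "H (Suc (i + k)) = H (i + k) @ [t]"
      using ext by blast
    then show ?case
      using Suc len[of "i + k"] by (simp add: nth_append)
  qed simp
  \<comment> \<open>The diagonal is the limit of the chain, because later histories extend earlier
    ones.\<close>
  define p where "p i = H i ! i" for i
  have "map p [0..<Suc n] = take (Suc n) (H n)" for n
  proof (rule nth_equalityI)
    show "length (map p [0..<Suc n]) = length (take (Suc n) (H n))"
      using len[of n] by simp
    fix i assume i: "i < length (map p [0..<Suc n])"
    then have "map p [0..<Suc n] ! i = H i ! i"
      by (simp add: p_def del: upt_Suc)
    also have "\<dots> = H n ! i"
      using nth[of i "n - i"] i by simp
    finally show "map p [0..<Suc n] ! i = take (Suc n) (H n) ! i"
      using i by simp
  qed
  then have "\<forall>n. consistent G \<sigma> (map p [0..<Suc n])"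
    using B consistent_take by (metis B_def)
  then show False
    using win unfolding winning_strategy_def by blast
qed


section \<open>Labelings induced by iterations\<close>

text \<open>Tests inspect a labeling only at worlds and schema variables, so the positions chosen by
  an arbitrary strategy are compared with iterations only there.\<close>

definition labels_iteration ::
  "('w, 'p) kripke \<Rightarrow> ('p, 'x) ggmsc \<Rightarrow> nat \<Rightarrow> ('w, 'x) labeling \<Rightarrow> bool" where
  "labels_iteration M \<Lambda> n f \<longleftrightarrow>
     (\<forall>v\<in>worlds M. \<forall>X\<in>schema_vars \<Lambda>. X \<in> f v \<longleftrightarrow> sat M v (iteration \<Lambda> n X))"

text \<open>The restricted abstraction meets the extensionality demanded by
  \<open>labeled_tuples\<close>.\<close>

definition iteration_labeling ::
  "('w, 'p) kripke \<Rightarrow> ('p, 'x) ggmsc \<Rightarrow> nat \<Rightarrow> ('w, 'x) labeling" where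
  "iteration_labeling M \<Lambda> n =
     (\<lambda>v\<in>worlds M. {X \<in> schema_vars \<Lambda>. sat M v (iteration \<Lambda> n X)})"

lemma iteration_labeling_in_labeled_tuples:
  "iteration_labeling M \<Lambda> n \<in> labeled_tuples M \<Lambda>"
  by (auto simp: iteration_labeling_def labeled_tuples_def)

lemma labels_iteration_iteration_labeling:
  "labels_iteration M \<Lambda> n (iteration_labeling M \<Lambda> n)"
  by (auto simp: iteration_labeling_def labels_iteration_def)

text \<open>Substitution lemma: replacing variables by formulas amounts to interpreting them by the
  extensions of these formulas. Both modalities range over worlds only, so agreement at worlds
  carries the induction.\<close>

lemma sat_subst_iff_sat_expand:
  assumes "\<And>u X. u \<in> worlds M \<Longrightarrow> Inr X \<in> atoms \<psi> \<Longrightarrow> X \<in> g u \<longleftrightarrow> sat M u (s X)"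
    and "v \<in> worlds M"
  shows "sat M v (subst s \<psi>) \<longleftrightarrow> sat (expand M g) v \<psi>"
  using assms
proof (induction \<psi> arbitrary: v)
  case (Atom a)
  then show ?case
    by (cases a) (auto simp: expand_def)
next
  case (Dia k \<psi>)
  then have "{u \<in> worlds M. (v, u) \<in> rel M \<and> sat M u (subst s \<psi>)} =
      {u \<in> worlds M. (v, u) \<in> rel M \<and> sat (expand M g) u \<psi>}"
    by auto
  then show ?case
    by (simp add: expand_def)
next
  case (Glob k \<psi>)
  then have "{u \<in> worlds M. sat M u (subst s \<psi>)} = {u \<in> worlds M. sat (expand M g) u \<psi>}"
    by auto
  then show ?case
    by (simp add: expand_def)
qed auto

lemma sat_iteration_Suc:
  assumes "is_program P \<Lambda>" and "labels_iteration M \<Lambda> n g"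
    and "v \<in> worlds M" and "X \<in> schema_vars \<Lambda>"
  shows "sat M v (iteration \<Lambda> (Suc n) X) \<longleftrightarrow> sat (expand M g) v (ind \<Lambda> X)"
proof -
  have "Y \<in> schema_vars \<Lambda>" if "Inr Y \<in> atoms (ind \<Lambda> X)" for Y
    using that assms(1,4) by (auto simp: is_program_def)
  then show ?thesis
    using assms(2,3) by (simp add: labels_iteration_def sat_subst_iff_sat_expand)
qed

lemma labels_iteration_0_iff:
  "labels_iteration M \<Lambda> 0 f \<longleftrightarrow>
     (\<forall>v\<in>worlds M. \<forall>X\<in>schema_vars \<Lambda>. gg_eloise_wins M \<Lambda> (FinalTest f v X))"
  by (simp add: labels_iteration_def)

text \<open>Links one round of the game to one step of the iteration; both directions of the theorem
  rest on it.\<close>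

lemma labels_iteration_Suc_iff:
  assumes "is_program P \<Lambda>" and "labels_iteration M \<Lambda> n g"
  shows "labels_iteration M \<Lambda> (Suc n) f \<longleftrightarrow>
     (\<forall>v\<in>worlds M. \<forall>X\<in>schema_vars \<Lambda>. gg_eloise_wins M \<Lambda> (Challenge f g v X))"
  using sat_iteration_Suc[OF assms] by (simp add: labels_iteration_def)


section \<open>From acceptance to a winning strategy\<close>

text \<open>Starting from \<open>n\<close>, the unchallenged play visits the labeling of iteration \<open>m\<close> as the state
  number \<open>2 * (n - m) + 2\<close>, so the strategy can read off \<open>m\<close> from the length of the history.\<close>

definition countdown ::
  "('w, 'p) kripke \<Rightarrow> ('p, 'x) ggmsc \<Rightarrow> nat \<Rightarrow> ('w, 'x) state list \<Rightarrow> ('w, 'x) state" where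
  "countdown M \<Lambda> n h =
     (case last h of
        Position f \<Rightarrow>
          (case n - (length h - 2) div 2 of
             0 \<Rightarrow> Declared f
           | Suc m \<Rightarrow> Offered f (iteration_labeling M \<Lambda> m))
      | _ \<Rightarrow> Position (iteration_labeling M \<Lambda> n))"

text \<open>Here \<open>l\<close> is the length of the history. It must be exact at positions, where
  the strategy decodes the index from it; at a challenge the play is over and a bound
  suffices.\<close>

fun countdown_inv ::
  "('w, 'p) kripke \<Rightarrow> ('p, 'x) ggmsc \<Rightarrow> nat \<Rightarrow> nat \<Rightarrow> ('w, 'x) state \<Rightarrow> bool" where
  "countdown_inv M \<Lambda> n l Start \<longleftrightarrow> l = 1"
| "countdown_inv M \<Lambda> n l (Position f) \<longleftrightarrow>
     (\<exists>m\<le>n. l = 2 * (n - m) + 2 \<and> f = iteration_labeling M \<Lambda> m)"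
| "countdown_inv M \<Lambda> n l (Declared f) \<longleftrightarrow>
     l = 2 * n + 3 \<and> f = iteration_labeling M \<Lambda> 0"
| "countdown_inv M \<Lambda> n l (FinalTest f v X) \<longleftrightarrow>
     l = 2 * n + 4 \<and> f = iteration_labeling M \<Lambda> 0 \<and> v \<in> worlds M \<and> X \<in> schema_vars \<Lambda>"
| "countdown_inv M \<Lambda> n l (Offered f g) \<longleftrightarrow>
     (\<exists>m<n. l = 2 * (n - m) + 1 \<and>
        f = iteration_labeling M \<Lambda> (Suc m) \<and> g = iteration_labeling M \<Lambda> m)"
| "countdown_inv M \<Lambda> n l (Challenge f g v X) \<longleftrightarrow>
     l \<le> 2 * n + 2 \<and>
     (\<exists>m. f = iteration_labeling M \<Lambda> (Suc m) \<and> g = iteration_labeling M \<Lambda> m) \<and>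
     v \<in> worlds M \<and> X \<in> schema_vars \<Lambda>"

lemma countdown_inv_length: "countdown_inv M \<Lambda> n l s \<Longrightarrow> l \<le> 2 * n + 4"
  by (cases s) auto

lemma countdown_inv_eloise:
  assumes "countdown_inv M \<Lambda> n (length h) (last h)" and "gg_eloise_turn (last h)"
  shows "countdown_inv M \<Lambda> n (Suc (length h)) (countdown M \<Lambda> n h)"
proof (cases "last h")
  case (Position f)
  with assms(1) obtain m where m: "m \<le> n" "length h = 2 * (n - m) + 2"
      "f = iteration_labeling M \<Lambda> m"
    by auto
  \<comment> \<open>Truncated subtraction is harmless here, since m \<le> n.\<close>
  then have "n - (length h - 2) div 2 = m"
    by simp
  then have \<sigma>: "countdown M \<Lambda> n h =
      (case m of 0 \<Rightarrow> Declared f | Suc k \<Rightarrow> Offered f (iteration_labeling M \<Lambda> k))"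
    by (simp only: countdown_def Position state.case)
  show ?thesis
  proof (cases m)
    case 0
    with m \<sigma> show ?thesis
      by simp
  next
    case (Suc k)
    with m have "k < n" and "Suc (length h) = 2 * (n - k) + 1"
      by simp_all
    with m(3) Suc \<sigma> show ?thesis
      by auto
  qed
qed (use assms in \<open>auto simp: countdown_def\<close>)

lemma countdown_inv_abelard:
  assumes "countdown_inv M \<Lambda> n l s" and "\<not> gg_eloise_turn s" and "t \<in> gg_moves M w \<Lambda> s"
  shows "countdown_inv M \<Lambda> n (Suc l) t"
proof (cases s)
  case (Offered f g)
  with assms(1) obtain m where m: "m < n" "l = 2 * (n - m) + 1" "g = iteration_labeling M \<Lambda> m"
      "f = iteration_labeling M \<Lambda> (Suc m)"
    by auto
  then have "m \<le> n" and "Suc l = 2 * (n - m) + 2"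
    by simp_all
  consider "t = Position g"
    | v X where "t = Challenge f g v X" "v \<in> worlds M" "X \<in> schema_vars \<Lambda>"
    using assms(3) Offered by auto
  then show ?thesis
  proof cases
    case 1
    show ?thesis
      using m(3) \<open>m \<le> n\<close> \<open>Suc l = _\<close> unfolding 1 countdown_inv.simps by blast
  next
    case (2 v X)
    have "Suc l \<le> 2 * n + 2"
      using \<open>Suc l = _\<close> by simp
    then show ?thesis
      using m(3,4) 2(2,3) unfolding 2(1) countdown_inv.simps by blast
  qed
qed (use assms in auto)

lemma countdown_invariant:
  assumes "consistent (global_game M w \<Lambda>) (countdown M \<Lambda> n) h"
  shows "countdown_inv M \<Lambda> n (length h) (last h)"
  using assms
proof induction
  case init
  show ?case by (simp add: global_game_def)
next
  case (eloise h)
  then show ?case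
    using countdown_inv_eloise by (simp add: global_game_def)
next
  case (abelard h t)
  then show ?case
    using countdown_inv_abelard by (fastforce simp: global_game_def)
qed

text \<open>Only the opening move is subject to a condition on acceptance, and \<open>X\<close>
  witnesses it at \<open>w\<close>.\<close>

lemma countdown_in_moves:
  assumes "w \<in> worlds M" and "X \<in> accepting \<Lambda>" and "X \<in> schema_vars \<Lambda>"
    and "sat M w (iteration \<Lambda> n X)" and "gg_eloise_turn (last h)"
  shows "countdown M \<Lambda> n h \<in> gg_moves M w \<Lambda> (last h)"
proof (cases "last h")
  case Start
  have "X \<in> iteration_labeling M \<Lambda> n w"
    using assms by (simp add: iteration_labeling_def)
  then show ?thesis
    using Start assms(2) iteration_labeling_in_labeled_tuples
    by (auto simp: countdown_def)
qed (use assms(5) iteration_labeling_in_labeled_tuples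
      in \<open>auto simp: countdown_def split: nat.split\<close>)

lemma countdown_inv_wins:
  assumes "is_program P \<Lambda>" and "w \<in> worlds M"
    and "X \<in> schema_vars \<Lambda>"
    and "countdown_inv M \<Lambda> n l s" and "\<not> gg_eloise_turn s" and "gg_moves M w \<Lambda> s = {}"
  shows "gg_eloise_wins M \<Lambda> s"
proof (cases s)
  \<comment> \<open>Not terminal: \<open>w\<close> and \<open>X\<close> provide Abelard with a final
    test.\<close>
  case (Declared f)
  then show ?thesis
    using assms(2,3,6) by auto
next
  case (FinalTest f v Y)
  then show ?thesis
    using assms(4) labels_iteration_iteration_labeling[of M \<Lambda> 0]
    unfolding labels_iteration_0_iff by simp
next
  case (Challenge f g v Y)
  then show ?thesis
    using assms(1,4) labels_iteration_iteration_labeling[of M \<Lambda>]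
      labels_iteration_Suc_iff[of P \<Lambda> M _ g f] by auto
qed (use assms in auto)

lemma winning_strategy_countdown:
  assumes "is_program P \<Lambda>" and "w \<in> worlds M"
    and "X \<in> accepting \<Lambda>" and "sat M w (iteration \<Lambda> n X)"
  shows "winning_strategy (global_game M w \<Lambda>) (countdown M \<Lambda> n)"
proof -
  let ?G = "global_game M w \<Lambda>" and ?\<sigma> = "countdown M \<Lambda> n"
  have X: "X \<in> schema_vars \<Lambda>"
    using assms(1,3) by (auto simp: is_program_def)
  have legal: "?\<sigma> h \<in> moves ?G (last h)" if "eloise_turn ?G (last h)" for h
    using countdown_in_moves[OF assms(2,3) X assms(4)] that by (simp add: global_game_def)
  have "eloise_wins ?G (last h)" if "consistent ?G ?\<sigma> h" and "moves ?G (last h) = {}" for h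
  proof -
    \<comment> \<open>By \<open>legal\<close>, Eloise always has a move at her own turn.\<close>
    have "\<not> eloise_turn ?G (last h)"
      using legal that(2) by auto
    then show ?thesis
      using countdown_inv_wins[OF assms(1,2) X countdown_invariant[OF that(1)]] that(2)
      by (simp add: global_game_def)
  qed
  \<comment> \<open>This prefix has length 2 * n + 5, one more than the invariant allows.\<close>
  moreover have "\<not> consistent ?G ?\<sigma> (map p [0..<Suc (2 * n + 4)])" for p
    using countdown_invariant[THEN countdown_inv_length] by fastforce
  ultimately show ?thesis
    using legal unfolding winning_strategy_def by blast
qed


section \<open>From a winning strategy to acceptance\<close>

lemma consistent_moveE:
  assumes "winning_strategy G \<sigma>" and "consistent G \<sigma> h"
    and "eloise_turn G (last h)"
  obtains "\<sigma> h \<in> moves G (last h)" and "consistent G \<sigma> (h @ [\<sigma> h])"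
  | "moves G (last h) = {}" and "eloise_wins G (last h)"
  using assms unfolding winning_strategy_def by (metis consistent.eloise)

text \<open>Abelard is free to pick any test, so a winning strategy must survive every one of
  them.\<close>

lemma winning_strategy_reply_wins:
  assumes "winning_strategy G \<sigma>" and "consistent G \<sigma> h"
    and "\<not> eloise_turn G (last h)" and "t \<in> moves G (last h)" and "moves G t = {}"
  shows "eloise_wins G t"
  using assms consistent.abelard[OF assms(2-4)] unfolding winning_strategy_def
  by (metis last_snoc)

text \<open>The index found counts the offers still to come if Abelard never challenges. The claim
  at an offer concerns \<open>g\<close>, the next position, and thus passes the information back to
  \<open>f\<close>.\<close>

lemma winning_strategy_labels_iteration:
  assumes "is_program P \<Lambda>"
    and win: "winning_strategy (global_game M w \<Lambda>) \<sigma>"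
    and "consistent (global_game M w \<Lambda>) \<sigma> h"
  shows "case last h of
      Position f \<Rightarrow> \<exists>n. labels_iteration M \<Lambda> n f
    | Offered f g \<Rightarrow> \<exists>n. labels_iteration M \<Lambda> n g
    | _ \<Rightarrow> True"
  using win assms(3)
proof (induction rule: winning_strategy_induct)
  case (step h)
  let ?G = "global_game M w \<Lambda>"
  have simps: "moves ?G = gg_moves M w \<Lambda>" "eloise_turn ?G = gg_eloise_turn"
      "eloise_wins ?G = gg_eloise_wins M \<Lambda>"
    by (simp_all add: global_game_def)
  show ?case
  proof (cases "last h")
    case (Position f)
    then have move: "\<sigma> h \<in> gg_moves M w \<Lambda> (Position f)"
      and cons: "consistent ?G \<sigma> (h @ [\<sigma> h])"
      using consistent_moveE[OF win step.hyps] by (auto simp: simps)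
    consider "\<sigma> h = Declared f" | g where "\<sigma> h = Offered f g"
      using move by auto
    then have "\<exists>n. labels_iteration M \<Lambda> n f"
    proof cases
      case 1
      have "gg_eloise_wins M \<Lambda> (FinalTest f v X)"
        if "v \<in> worlds M" and "X \<in> schema_vars \<Lambda>" for v X
        using winning_strategy_reply_wins[OF win cons, of "FinalTest f v X"] 1 that
        by (simp add: simps)
      then show ?thesis
        using labels_iteration_0_iff by blast
    next
      case (2 g)
      then obtain n where n: "labels_iteration M \<Lambda> n g"
        using step.IH[OF cons] by auto
      have "gg_eloise_wins M \<Lambda> (Challenge f g v X)"
        if "v \<in> worlds M" and "X \<in> schema_vars \<Lambda>" for v X
        using winning_strategy_reply_wins[OF win cons, of "Challenge f g v X"] 2 that
        by (simp add: simps)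
      then show ?thesis
        using labels_iteration_Suc_iff[OF assms(1) n] by blast
    qed
    then show ?thesis
      using Position by simp
  next
    case (Offered f g)
    then have "consistent ?G \<sigma> (h @ [Position g])"
      by (intro consistent.abelard step.hyps) (simp_all add: simps)
    from step.IH[OF this] show ?thesis
      using Offered by simp
  qed simp_all
qed

lemma winning_strategy_imp_accepts:
  assumes "is_program P \<Lambda>" and "w \<in> worlds M"
    and win: "winning_strategy (global_game M w \<Lambda>) \<sigma>"
  shows "accepts M w \<Lambda>"
proof -
  let ?G = "global_game M w \<Lambda>"
  have "consistent ?G \<sigma> [Start]"
    using consistent.init[of ?G \<sigma>] by (simp add: global_game_def)
  \<comment> \<open>The terminal alternative is impossible, because \<open>gg_eloise_wins\<close> is
    false at \<open>Start\<close>.\<close>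
  then have move: "\<sigma> [Start] \<in> gg_moves M w \<Lambda> Start"
    and cons: "consistent ?G \<sigma> ([Start] @ [\<sigma> [Start]])"
    using consistent_moveE[OF win] by (fastforce simp: global_game_def)+
  from move obtain f X where f: "\<sigma> [Start] = Position f" and X: "X \<in> accepting \<Lambda>" "X \<in> f w"
    by auto
  obtain n where "labels_iteration M \<Lambda> n f"
    using winning_strategy_labels_iteration[OF assms(1) win cons] f by auto
  moreover have "X \<in> schema_vars \<Lambda>"
    using assms(1) X(1) by (auto simp: is_program_def)
  ultimately have "sat M w (iteration \<Lambda> n X)"
    using assms(2) X(2) by (simp add: labels_iteration_def)
  then show ?thesis
    using X(1) by (auto simp: accepts_def)
qed

theorem mainTheorem3:
  fixes P :: "'p set"
    and M :: "('w, 'p) kripke"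
    and w :: 'w
    and \<Lambda> :: "('p, 'x) ggmsc"
  assumes "is_pointed_model P M w"
    and "is_program P \<Lambda>"
  shows "accepts M w \<Lambda> \<longleftrightarrow> (\<exists>\<sigma>. winning_strategy (global_game M w \<Lambda>) \<sigma>)"
proof -
  have w: "w \<in> worlds M"
    using assms(1) by (simp add: is_pointed_model_def)
  show ?thesis
    using winning_strategy_countdown[OF assms(2) w] winning_strategy_imp_accepts[OF assms(2) w]
    unfolding accepts_def by blast
qed

end
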